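(* Let $\gamma(s)$ be a null curve in $E_1^4$ with Frenet vector fields $F_1,F_2,F_3,F_4$. The tubular hypersurfaces that are formed as the envelope of a family of pseudo hyperspheres of constant radius $r$ whose centers lie on $\gamma(s)$ can be parametrized by $$T_1(s,t,w)=\gamma(s)+a_1(s,t,w)F_1(s)+a_2(s,t,w)F_2(s)+a_4(s,t,w)F_4(s),$$ where $a_2(s,t,w)^2+a_4(s,t,w)^2=r^2$. There are no tubular hypersurfaces that are formed as the envelope of a family of pseudo hyperbolic hyperspheres (of constant radius) whose centers lie on a null curve $\gamma(s)$ in $E_1^4$.
   Context: $E_1^4$ is $\mathbb{R}^4$ with $\langle u,v\rangle=-u_1v_1+u_2v_2+u_3v_3+u_4v_4$. A null curve is a curve $\gamma(s)$ with all velocity vectors null (parametrized so that $\langle\gamma'',\gamma''\rangle=1$ when it is not a straight line); it has a Frenet frame $F_1=\gamma',F_2,F_3,F_4$ with $\langle F_2,F_2\rangle=\langle F_4,F_4\rangle=\langle F_1,F_3\rangle=1$, all other products $\langle F_i,F_j\rangle$ zero, and $F_1'=k_1F_2$, $F_2'=k_2F_1-k_1F_3$, $F_3'=-k_2F_2+k_3F_4$, $F_4'=-k_3F_1$, where $k_1=0$ if $\gamma$ is a straight line and $k_1=1$ otherwise. The pseudo hypersphere (resp. pseudo hyperbolic hypersphere) with center $p$ and radius $r>0$ is $\{u:\langle u-p,u-p\rangle=r^2\}$ (resp. $\{u:\langle u-p,u-p\rangle=-r^2\}$). With $\lambda=1$ for pseudo hyperspheres and $\lambda=-1$ for pseudo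 hyperbolic hyperspheres, a hypersurface $T(s,t,w)$ is (formed as) the envelope of the family with centers $\gamma(s)$ and constant radius $r>0$ (a tubular hypersurface) if $\langle T-\gamma,T-\gamma\rangle=\lambda r^2$ and $T(s,t,w)-\gamma(s)$ is normal to the hypersurface (in particular $\langle T-\gamma,\partial T/\partial s\rangle=0$). The $a_i(s,t,w)$ are differentiable real functions. *)

theory Defs
  imports "HOL-Analysis.Analysis"
begin

definition minkowski :: "real^4 \<Rightarrow> real^4 \<Rightarrow> real" where
  "minkowski u v = - (u$1 * v$1) + u$2 * v$2 + u$3 * v$3 + u$4 * v$4"

definition null_vector :: "real^4 \<Rightarrow> bool" where
  "null_vector v \<longleftrightarrow> v \<noteq> 0 \<and> minkowski v v = 0"

abbreviation velocity :: "(real \<Rightarrow> real^4) \<Rightarrow> real \<Rightarrow> real^4" where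
  "velocity \<gamma> \<equiv> (\<lambda>s. vector_derivative \<gamma> (at s))"

definition straight_line_on :: "real set \<Rightarrow> (real \<Rightarrow> real^4) \<Rightarrow> bool" where
  "straight_line_on I \<gamma> \<longleftrightarrow> collinear (\<gamma> ` I)"

text \<open>The last conjunct is the normalisation of the parameter (pseudo-arc length).\<close>

definition null_curve_on :: "real set \<Rightarrow> (real \<Rightarrow> real^4) \<Rightarrow> bool" where
  "null_curve_on I \<gamma> \<longleftrightarrow>
     \<gamma> differentiable_on I \<and> velocity \<gamma> differentiable_on I \<and>
     (\<forall>s\<in>I. null_vector (velocity \<gamma> s)) \<and>
     (\<not> straight_line_on I \<gamma> \<longrightarrow>
        (\<forall>s\<in>I. minkowski (velocity (velocity \<gamma>) s) (velocity (velocity \<gamma>) s) = 1))"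

text \<open>The first curvature is a constant determined by the curve, so it is not a parameter.\<close>

definition first_curvature :: "real set \<Rightarrow> (real \<Rightarrow> real^4) \<Rightarrow> real" where
  "first_curvature I \<gamma> = (if straight_line_on I \<gamma> then 0 else 1)"

definition frenet_frame_on ::
  "real set \<Rightarrow> (real \<Rightarrow> real^4) \<Rightarrow>
   (real \<Rightarrow> real^4) \<Rightarrow> (real \<Rightarrow> real^4) \<Rightarrow> (real \<Rightarrow> real^4) \<Rightarrow> (real \<Rightarrow> real^4) \<Rightarrow>
   (real \<Rightarrow> real) \<Rightarrow> (real \<Rightarrow> real) \<Rightarrow> bool" where
  "frenet_frame_on I \<gamma> F1 F2 F3 F4 k2 k3 \<longleftrightarrow>
     (let k1 = first_curvature I \<gamma> in
      \<forall>s\<in>I.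
        minkowski (F2 s) (F2 s) = 1 \<and> minkowski (F4 s) (F4 s) = 1 \<and>
        minkowski (F1 s) (F3 s) = 1 \<and>
        minkowski (F1 s) (F1 s) = 0 \<and> minkowski (F3 s) (F3 s) = 0 \<and>
        minkowski (F1 s) (F2 s) = 0 \<and> minkowski (F1 s) (F4 s) = 0 \<and>
        minkowski (F2 s) (F3 s) = 0 \<and> minkowski (F2 s) (F4 s) = 0 \<and>
        minkowski (F3 s) (F4 s) = 0 \<and>
        (\<gamma> has_vector_derivative F1 s) (at s) \<and>
        (F1 has_vector_derivative k1 *\<^sub>R F2 s) (at s) \<and>
        (F2 has_vector_derivative k2 s *\<^sub>R F1 s - k1 *\<^sub>R F3 s) (at s) \<and>
        (F3 has_vector_derivative - k2 s *\<^sub>R F2 s + k3 s *\<^sub>R F4 s) (at s) \<and>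
        (F4 has_vector_derivative - k3 s *\<^sub>R F1 s) (at s))"

definition pseudo_hypersphere :: "real^4 \<Rightarrow> real \<Rightarrow> (real^4) set" where
  "pseudo_hypersphere p r = {u. minkowski (u - p) (u - p) = r\<^sup>2}"

definition pseudo_hyperbolic_hypersphere :: "real^4 \<Rightarrow> real \<Rightarrow> (real^4) set" where
  "pseudo_hyperbolic_hypersphere p r = {u. minkowski (u - p) (u - p) = - r\<^sup>2}"

text \<open>Domains of the parameters \<open>(s, t, w)\<close>, where \<open>s\<close> is the parameter of the curve.\<close>

definition parameter_domain :: "real set \<Rightarrow> (real \<times> real \<times> real) set \<Rightarrow> bool" where
  "parameter_domain I U \<longleftrightarrow> open U \<and> U \<noteq> {} \<and> fst ` U \<subseteq> I"

text \<open>
  The space tangent to a parametrised hypersurface \<open>T\<close> at a parameter point is the range of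
  its Frechet derivative, spanned by the three partial derivatives.
\<close>

definition normal_to_hypersurface_at ::
  "(real \<times> real \<times> real \<Rightarrow> real^4) \<Rightarrow> real \<times> real \<times> real \<Rightarrow> real^4 \<Rightarrow> bool" where
  "normal_to_hypersurface_at T x n \<longleftrightarrow>
     (\<forall>v \<in> range (frechet_derivative T (at x)). minkowski n v = 0)"

text \<open>
  \<open>S s\<close> is the member of the family with centre \<open>\<gamma> s\<close>. Linear independence of the partial
  derivatives of \<open>T\<close> is deliberately not required: if \<open>\<gamma>\<close> is a null straight line, no
  \<open>T\<close> satisfying the other conditions for pseudo hyperspheres has it.
\<close>

definition tubular_hypersurface_on ::
  "(real \<times> real \<times> real) set \<Rightarrow> (real \<Rightarrow> real^4) \<Rightarrow> (real \<Rightarrow> (real^4) set) \<Rightarrow>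
   (real \<times> real \<times> real \<Rightarrow> real^4) \<Rightarrow> bool" where
  "tubular_hypersurface_on U \<gamma> S T \<longleftrightarrow>
     T differentiable_on U \<and>
     (\<forall>(s, t, w) \<in> U.
        T (s, t, w) \<in> S s \<and>
        normal_to_hypersurface_at T (s, t, w) (T (s, t, w) - \<gamma> s))"

end

theory Submission
  imports Defs
begin

text \<open>
  Everything rests on one observation about a point \<open>T (s, t, w)\<close> of the hypersurface and its
  radius vector \<open>n = T - \<gamma>\<close>. As \<open>\<langle>n, n\<rangle>\<close> is a constant on an open set of parameters,
  differentiating it gives \<open>\<langle>n, dT v\<rangle> = \<langle>n, d\<gamma> v\<rangle>\<close> for every direction \<open>v = (v\<^sub>s, v\<^sub>t, v\<^sub>w)\<close>
  of the parameter space. The centre depends on \<open>s\<close> only, so the right-hand side is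
  \<open>v\<^sub>s \<langle>n, F\<^sub>1\<rangle>\<close>. Hence, as long as the points lie on the members of the family, normality of
  \<open>n\<close> to the whole hypersurface is the single scalar equation \<open>\<langle>n, F\<^sub>1\<rangle> = 0\<close>
  (lemma \<open>normal_iff_orthogonal_to_centre_velocity\<close>).

  In the null frame, \<open>\<langle>n, F\<^sub>1\<rangle>\<close> is the coordinate of \<open>n\<close> along \<open>F\<^sub>3\<close>
  (lemma \<open>null_frame_expansion\<close>), so this coordinate vanishes and
  \<open>n = a\<^sub>1 F\<^sub>1 + a\<^sub>2 F\<^sub>2 + a\<^sub>4 F\<^sub>4\<close>. On such vectors the metric is positive semidefinite:
  \<open>\<langle>n, n\<rangle> = a\<^sub>2\<^sup>2 + a\<^sub>4\<^sup>2\<close>, because \<open>F\<^sub>1\<close> is null and orthogonal to \<open>F\<^sub>2\<close> and \<open>F\<^sub>4\<close>. For pseudo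
  hyperspheres this is the asserted parametrization, and the coordinates are differentiable
  because they are products of \<open>n\<close> with frame vectors. For pseudo hyperbolic hyperspheres it
  would make \<open>- r\<^sup>2\<close> nonnegative.
\<close>

section \<open>The Minkowski product and null frames\<close>

lemma bilinear_minkowski: "bilinear minkowski"
  unfolding bilinear_def
  by (intro conjI allI linearI) (simp_all add: minkowski_def algebra_simps)

lemma bounded_bilinear_minkowski: "bounded_bilinear minkowski"
  using bilinear_minkowski bilinear_conv_bounded_bilinear by blast

interpretation minkowski: bounded_bilinear minkowski
  by (rule bounded_bilinear_minkowski)

lemma minkowski_commute: "minkowski u v = minkowski v u"
  by (simp add: minkowski_def mult.commute)

definition null_frame :: "real^4 \<Rightarrow> real^4 \<Rightarrow> real^4 \<Rightarrow> real^4 \<Rightarrow> bool" where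
  "null_frame f1 f2 f3 f4 \<longleftrightarrow>
     minkowski f1 f1 = 0 \<and> minkowski f2 f2 = 1 \<and> minkowski f3 f3 = 0 \<and> minkowski f4 f4 = 1 \<and>
     minkowski f1 f2 = 0 \<and> minkowski f1 f3 = 1 \<and> minkowski f1 f4 = 0 \<and>
     minkowski f2 f3 = 0 \<and> minkowski f2 f4 = 0 \<and> minkowski f3 f4 = 0"

lemma null_frame_products:
  assumes "null_frame f1 f2 f3 f4"
  shows "minkowski (a1 *\<^sub>R f1 + a2 *\<^sub>R f2 + a3 *\<^sub>R f3 + a4 *\<^sub>R f4) f1 = a3"
    and "minkowski (a1 *\<^sub>R f1 + a2 *\<^sub>R f2 + a3 *\<^sub>R f3 + a4 *\<^sub>R f4) f2 = a2"
    and "minkowski (a1 *\<^sub>R f1 + a2 *\<^sub>R f2 + a3 *\<^sub>R f3 + a4 *\<^sub>R f4) f3 = a1"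
    and "minkowski (a1 *\<^sub>R f1 + a2 *\<^sub>R f2 + a3 *\<^sub>R f3 + a4 *\<^sub>R f4) f4 = a4"
  using assms
  by (simp_all add: null_frame_def minkowski.add_left minkowski.scaleR_left
      minkowski_commute[of f2 f1] minkowski_commute[of f3 f1] minkowski_commute[of f4 f1]
      minkowski_commute[of f3 f2] minkowski_commute[of f4 f2] minkowski_commute[of f4 f3])

text \<open>
  The products with the frame vectors recover the coefficients of a combination, so the map from
  coefficients to combinations is injective; between spaces of equal dimension it is then
  surjective. As \<open>f1\<close> and \<open>f3\<close> are null with product \<open>1\<close>, each of them reads off the
  coefficient of the other.
\<close>

lemma null_frame_expansion:
  assumes "null_frame f1 f2 f3 f4"
  shows "v = minkowski v f3 *\<^sub>R f1 + minkowski v f2 *\<^sub>R f2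
              + minkowski v f1 *\<^sub>R f3 + minkowski v f4 *\<^sub>R f4"
proof -
  let ?comb = "\<lambda>c :: real^4. c$1 *\<^sub>R f1 + c$2 *\<^sub>R f2 + c$3 *\<^sub>R f3 + c$4 *\<^sub>R f4"
  have lin: "linear ?comb"
    by (intro linearI) (simp_all add: algebra_simps)
  have "inj ?comb"
  proof (rule injI)
    fix c d :: "real^4"
    assume eq: "?comb c = ?comb d"
    show "c = d"
      using null_frame_products[OF assms, of "c$1" "c$2" "c$3" "c$4"]
        null_frame_products[OF assms, of "d$1" "d$2" "d$3" "d$4"]
      unfolding eq by (simp add: vec_eq_iff forall_4)
  qed
  then have "surj ?comb"
    by (rule linear_inj_imp_surj[OF lin])
  then obtain c where "v = ?comb c"
    by (rule surjE)
  then show ?thesis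
    using null_frame_products[OF assms, of "c$1" "c$2" "c$3" "c$4"] by simp
qed

text \<open>The metric is degenerate in the hyperplane orthogonal to \<open>f1\<close>, but not indefinite.\<close>

lemma minkowski_self_orthogonal_to_null:
  assumes "null_frame f1 f2 f3 f4"
  shows "minkowski (a1 *\<^sub>R f1 + a2 *\<^sub>R f2 + a4 *\<^sub>R f4) (a1 *\<^sub>R f1 + a2 *\<^sub>R f2 + a4 *\<^sub>R f4)
           = a2\<^sup>2 + a4\<^sup>2"
  using assms
  by (simp add: null_frame_def minkowski.add_left minkowski.add_right minkowski.scaleR_left
      minkowski.scaleR_right minkowski_commute[of f2 f1] minkowski_commute[of f4 f1]
      minkowski_commute[of f4 f2] power2_eq_square)

lemma frenet_frame_on_null_frame:
  assumes "frenet_frame_on I \<gamma> F1 F2 F3 F4 k2 k3" and "s \<in> I"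
  shows "null_frame (F1 s) (F2 s) (F3 s) (F4 s)"
  using assms by (simp add: frenet_frame_on_def null_frame_def Let_def)

lemma frenet_frame_on_differentiable:
  assumes "frenet_frame_on I \<gamma> F1 F2 F3 F4 k2 k3" and "s \<in> I"
  shows "(\<gamma> has_vector_derivative F1 s) (at s)"
    and "F1 differentiable at s" and "F2 differentiable at s"
    and "F3 differentiable at s" and "F4 differentiable at s"
  using assms by (auto simp: frenet_frame_on_def Let_def intro: differentiableI_vector)

section \<open>Normality of the radius vector\<close>

lemma has_derivative_compose_fst:
  fixes f :: "real \<Rightarrow> 'a::real_normed_vector" and x :: "real \<times> 'b::real_normed_vector"
  assumes "(f has_vector_derivative f') (at (fst x))"
  shows "((\<lambda>y. f (fst y)) has_derivative (\<lambda>v. fst v *\<^sub>R f')) (at x)"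
  using has_derivative_compose[OF has_derivative_fst[OF has_derivative_ident]
      assms[unfolded has_vector_derivative_def]] .

lemma differentiable_compose_fst:
  fixes f :: "real \<Rightarrow> 'a::real_normed_vector" and x :: "real \<times> 'b::real_normed_vector"
  assumes "f differentiable at (fst x)"
  shows "(\<lambda>y. f (fst y)) differentiable (at x)"
  using has_derivative_compose_fst assms
  by (metis differentiableI vector_derivative_works)

lemma differentiable_minkowski:
  assumes "f differentiable (at x within S)" and "g differentiable (at x within S)"
  shows "(\<lambda>y. minkowski (f y) (g y)) differentiable (at x within S)"
  using assms minkowski.FDERIV unfolding differentiable_def by blast

text \<open>
  Differentiating the constant \<open>\<langle>n, n\<rangle>\<close>, with \<open>n\<close> the radius vector, shows that \<open>dT v\<close> and the
  velocity \<open>v\<^sub>s \<gamma>'(s)\<close> of the centre have the same product with \<open>n\<close>. The direction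
  \<open>(1, 0, 0)\<close> turns the equality for all \<open>v\<close> into the stated equation.
\<close>

lemma normal_iff_orthogonal_to_centre_velocity:
  fixes T :: "real \<times> real \<times> real \<Rightarrow> real^4"
  assumes "open U" and "x \<in> U" and T: "T differentiable (at x)"
    and \<gamma>: "(\<gamma> has_vector_derivative d) (at (fst x))"
    and const: "\<And>y. y \<in> U \<Longrightarrow> minkowski (T y - \<gamma> (fst y)) (T y - \<gamma> (fst y)) = c"
  shows "normal_to_hypersurface_at T x (T x - \<gamma> (fst x))
           \<longleftrightarrow> minkowski (T x - \<gamma> (fst x)) d = 0"
proof -
  let ?n = "\<lambda>y. T y - \<gamma> (fst y)" and ?D = "frechet_derivative T (at x)"
  have n': "(?n has_derivative (\<lambda>v. ?D v - fst v *\<^sub>R d)) (at x)"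
    using T \<gamma>
    by (intro has_derivative_diff has_derivative_compose_fst) (simp_all add: frechet_derivative_works)
  have "((\<lambda>y. minkowski (?n y) (?n y)) has_derivative (\<lambda>v. 0)) (at x)"
    by (rule has_derivative_transform_within_open[OF has_derivative_const \<open>open U\<close> \<open>x \<in> U\<close>])
      (simp add: const)
  then have "(\<lambda>v. minkowski (?n x) (?D v - fst v *\<^sub>R d) + minkowski (?D v - fst v *\<^sub>R d) (?n x))
               = (\<lambda>v. 0)"
    by (rule has_derivative_unique[OF minkowski.FDERIV[OF n' n']])
  then have "minkowski (?n x) (?D v - fst v *\<^sub>R d) = 0" for v
    by (auto simp: minkowski_commute[of "_ - _ *\<^sub>R d" "?n x"] dest: fun_cong[of _ _ v])
  then have "minkowski (?n x) (?D v) = fst v * minkowski (?n x) d" for v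
    by (simp add: minkowski.diff_right minkowski.scaleR_right)
  then have "normal_to_hypersurface_at T x (?n x)
               \<longleftrightarrow> (\<forall>v :: real \<times> real \<times> real. fst v * minkowski (?n x) d = 0)"
    by (simp add: normal_to_hypersurface_at_def)
  also have "\<dots> \<longleftrightarrow> minkowski (?n x) d = 0"
    by (metis fst_conv mult_1 mult_zero_right)
  finally show ?thesis .
qed

text \<open>
  Pseudo hyperspheres and pseudo hyperbolic hyperspheres differ only in the value \<open>c\<close> of
  \<open>\<langle>n, n\<rangle>\<close>, which may here be any real number; its sign is what separates the two cases.
\<close>

lemma tubular_hypersurface_on_iff:
  assumes frame: "frenet_frame_on I \<gamma> F1 F2 F3 F4 k2 k3" and dom: "parameter_domain I U"
  shows "tubular_hypersurface_on U \<gamma> (\<lambda>s. {u. minkowski (u - \<gamma> s) (u - \<gamma> s) = c}) T \<longleftrightarrow>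
         (\<exists>a1 a2 a4 :: real \<times> real \<times> real \<Rightarrow> real.
            a1 differentiable_on U \<and> a2 differentiable_on U \<and> a4 differentiable_on U \<and>
            (\<forall>(s, t, w) \<in> U.
               T (s, t, w) = \<gamma> s + a1 (s, t, w) *\<^sub>R F1 s + a2 (s, t, w) *\<^sub>R F2 s
                                 + a4 (s, t, w) *\<^sub>R F4 s \<and>
               (a2 (s, t, w))\<^sup>2 + (a4 (s, t, w))\<^sup>2 = c))"
    (is "?tube \<longleftrightarrow> (\<exists>a1 a2 a4. ?param a1 a2 a4)")
proof -
  let ?n = "\<lambda>y. T y - \<gamma> (fst y)"
  have U: "open U"
    using dom by (simp add: parameter_domain_def)
  have in_I: "fst y \<in> I" if "y \<in> U" for y
    using dom that by (auto simp: parameter_domain_def)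
  note diff = frenet_frame_on_differentiable[OF frame in_I]
  have diff_at: "f differentiable (at y)" if "f differentiable_on U" "y \<in> U"
    for f :: "real \<times> real \<times> real \<Rightarrow> 'a::real_normed_vector" and y
    using that U by (metis differentiable_on_def at_within_open)
  show ?thesis
  proof
    assume tube: ?tube
    then have T: "T differentiable_on U"
      and on: "\<And>y. y \<in> U \<Longrightarrow> minkowski (?n y) (?n y) = c"
      and normal: "\<And>y. y \<in> U \<Longrightarrow> normal_to_hypersurface_at T y (?n y)"
      by (auto simp: tubular_hypersurface_on_def)
    let ?a1 = "\<lambda>y. minkowski (?n y) (F3 (fst y))"
      and ?a2 = "\<lambda>y. minkowski (?n y) (F2 (fst y))"
      and ?a4 = "\<lambda>y. minkowski (?n y) (F4 (fst y))"
    have n: "?n differentiable (at y)" if "y \<in> U" for y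
      using diff(1)[OF that] diff_at[OF T that]
      by (intro differentiable_diff differentiable_compose_fst) (auto intro: differentiableI_vector)
    have "?a1 differentiable_on U" "?a2 differentiable_on U" "?a4 differentiable_on U"
      by (intro differentiable_at_imp_differentiable_on differentiable_minkowski n
          differentiable_compose_fst diff; assumption)+
    moreover have "?n y = ?a1 y *\<^sub>R F1 (fst y) + ?a2 y *\<^sub>R F2 (fst y) + ?a4 y *\<^sub>R F4 (fst y)"
      (is "_ = ?comb y") and "(?a2 y)\<^sup>2 + (?a4 y)\<^sup>2 = c" if y: "y \<in> U" for y
    proof -
      note nf = frenet_frame_on_null_frame[OF frame in_I[OF y]]
      have "minkowski (?n y) (F1 (fst y)) = 0"
        using normal_iff_orthogonal_to_centre_velocity[OF U y diff_at[OF T y] diff(1)[OF y] on]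
          normal[OF y] by blast
      then show n_eq: "?n y = ?comb y"
        using null_frame_expansion[OF nf, of "?n y"] by simp
      show "(?a2 y)\<^sup>2 + (?a4 y)\<^sup>2 = c"
        using minkowski_self_orthogonal_to_null[OF nf, of "?a1 y" "?a2 y" "?a4 y"] on[OF y]
        by (simp only: n_eq[symmetric])
    qed
    then have "\<forall>(s, t, w) \<in> U.
        T (s, t, w) = \<gamma> s + ?a1 (s, t, w) *\<^sub>R F1 s + ?a2 (s, t, w) *\<^sub>R F2 s
                          + ?a4 (s, t, w) *\<^sub>R F4 s \<and>
        (?a2 (s, t, w))\<^sup>2 + (?a4 (s, t, w))\<^sup>2 = c"
      by (fastforce simp: algebra_simps)
    ultimately show "\<exists>a1 a2 a4. ?param a1 a2 a4"
      by blast
  next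
    assume "\<exists>a1 a2 a4. ?param a1 a2 a4"
    then obtain a1 a2 a4 where a: "?param a1 a2 a4" by blast
    let ?comb = "\<lambda>y. a1 y *\<^sub>R F1 (fst y) + a2 y *\<^sub>R F2 (fst y) + a4 y *\<^sub>R F4 (fst y)"
    have T_eq: "T y = \<gamma> (fst y) + ?comb y" and sq: "(a2 y)\<^sup>2 + (a4 y)\<^sup>2 = c" if "y \<in> U" for y
      using a that by (cases y; fastforce simp: algebra_simps)+
    have "(\<lambda>y. \<gamma> (fst y) + ?comb y) differentiable (at y)" if y: "y \<in> U" for y
      using a diff[OF y] diff_at[OF _ y]
      by (intro differentiable_add differentiable_scaleR differentiable_compose_fst)
        (auto intro: differentiableI_vector)
    then have "(\<lambda>y. \<gamma> (fst y) + ?comb y) differentiable_on U"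
      by (rule differentiable_at_imp_differentiable_on)
    then have T: "T differentiable_on U"
      using T_eq by (simp add: differentiable_on_def) (metis (no_types, lifting) differentiable_transform_within zero_less_one)
    have on: "minkowski (?n y) (?n y) = c" if y: "y \<in> U" for y
      using minkowski_self_orthogonal_to_null[OF frenet_frame_on_null_frame[OF frame in_I[OF y]]]
      by (simp add: T_eq[OF y] sq[OF y])
    \<comment> \<open>There is no component along \<open>F3\<close>, the only frame vector not orthogonal to \<open>F1\<close>.\<close>
    have "normal_to_hypersurface_at T y (?n y)" if y: "y \<in> U" for y
    proof -
      have "minkowski (?n y) (F1 (fst y)) = 0"
        using null_frame_products(1)[OF frenet_frame_on_null_frame[OF frame in_I[OF y]],
            of "a1 y" "a2 y" 0 "a4 y"]
        by (simp add: T_eq[OF y])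
      then show ?thesis
        using normal_iff_orthogonal_to_centre_velocity[OF U y diff_at[OF T y] diff(1)[OF y] on]
          by blast
    qed
    then show ?tube
      using T on by (auto simp: tubular_hypersurface_on_def)
  qed
qed

section \<open>Tubular hypersurfaces around null curves\<close>

theorem theorem12:
  fixes I :: "real set" and \<gamma> F1 F2 F3 F4 :: "real \<Rightarrow> real^4"
    and k2 k3 :: "real \<Rightarrow> real" and r :: real
  assumes "open I" and "is_interval I" and "I \<noteq> {}"
    and "null_curve_on I \<gamma>"
    and "frenet_frame_on I \<gamma> F1 F2 F3 F4 k2 k3"
    and "r > 0"
  shows "(\<forall>U T. parameter_domain I U \<longrightarrow>
            (tubular_hypersurface_on U \<gamma> (\<lambda>s. pseudo_hypersphere (\<gamma> s) r) T \<longleftrightarrow>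
             (\<exists>a1 a2 a4 :: real \<times> real \<times> real \<Rightarrow> real.
                a1 differentiable_on U \<and> a2 differentiable_on U \<and> a4 differentiable_on U \<and>
                (\<forall>(s, t, w) \<in> U.
                   T (s, t, w) = \<gamma> s + a1 (s, t, w) *\<^sub>R F1 s + a2 (s, t, w) *\<^sub>R F2 s
                                     + a4 (s, t, w) *\<^sub>R F4 s \<and>
                   (a2 (s, t, w))\<^sup>2 + (a4 (s, t, w))\<^sup>2 = r\<^sup>2))))
       \<and> \<not> (\<exists>U T. parameter_domain I U \<and>
            tubular_hypersurface_on U \<gamma> (\<lambda>s. pseudo_hyperbolic_hypersphere (\<gamma> s) r) T)"
proof (intro conjI allI impI)
  fix U T
  assume "parameter_domain I U"
  then show "tubular_hypersurface_on U \<gamma> (\<lambda>s. pseudo_hypersphere (\<gamma> s) r) T \<longleftrightarrow>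
             (\<exists>a1 a2 a4 :: real \<times> real \<times> real \<Rightarrow> real.
                a1 differentiable_on U \<and> a2 differentiable_on U \<and> a4 differentiable_on U \<and>
                (\<forall>(s, t, w) \<in> U.
                   T (s, t, w) = \<gamma> s + a1 (s, t, w) *\<^sub>R F1 s + a2 (s, t, w) *\<^sub>R F2 s
                                     + a4 (s, t, w) *\<^sub>R F4 s \<and>
                   (a2 (s, t, w))\<^sup>2 + (a4 (s, t, w))\<^sup>2 = r\<^sup>2))"
    unfolding pseudo_hypersphere_def by (rule tubular_hypersurface_on_iff[OF assms(5)])
next
  show "\<not> (\<exists>U T. parameter_domain I U \<and>
            tubular_hypersurface_on U \<gamma> (\<lambda>s. pseudo_hyperbolic_hypersphere (\<gamma> s) r) T)"
  proof
    assume "\<exists>U T. parameter_domain I U \<and>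
              tubular_hypersurface_on U \<gamma> (\<lambda>s. pseudo_hyperbolic_hypersphere (\<gamma> s) r) T"
    then obtain U T where dom: "parameter_domain I U"
      and tube: "tubular_hypersurface_on U \<gamma> (\<lambda>s. pseudo_hyperbolic_hypersphere (\<gamma> s) r) T"
      by blast
    obtain a2 a4 :: "real \<times> real \<times> real \<Rightarrow> real"
      where "\<forall>(s, t, w) \<in> U. (a2 (s, t, w))\<^sup>2 + (a4 (s, t, w))\<^sup>2 = - r\<^sup>2"
      using tube[unfolded pseudo_hyperbolic_hypersphere_def
          tubular_hypersurface_on_iff[OF assms(5) dom]] by fast
    moreover obtain s t w where "(s, t, w) \<in> U"
      using dom by (auto simp: parameter_domain_def)
    ultimately have "(a2 (s, t, w))\<^sup>2 + (a4 (s, t, w))\<^sup>2 = - r\<^sup>2"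
      by blast
    moreover have "r\<^sup>2 > 0"
      using \<open>r > 0\<close> by simp
    ultimately show False
      by (smt (verit) zero_le_power2)
  qed
qed

end
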